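(* Let $G$ be a weighted signed block graph. If every triangle in $G$ is balanced, then $\mathrm{per}\, A(G)=\mathrm{per}\, A(|G|)$.
   Context: A weighted signed graph is a simple undirected graph whose edges carry nonzero real weights; its adjacency matrix $A(G)$ has $(i,j)$ entry equal to the weight of edge $\{i,j\}$ and $0$ otherwise. $|G|$ is obtained by replacing every edge weight by its absolute value. A cycle (in particular a triangle, i.e. a $3$-cycle) is balanced if the product of its edge weights is positive. A block is a maximal connected subgraph without a cut-vertex; a block graph is a graph each of whose blocks is a complete graph. $\mathrm{per}$ denotes the permanent. *)

theory Defs
  imports
    Complex_Main
    "HOL-Combinatorics.Permutations"
    "Graph_Theory.Kuratowski"
    "Graph_Theory.Weighted_Graph"
begin

text \<open>An undirected simple graph is a symmetric loop-free digraph (\<^locale>\<open>pair_graph\<close>);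
  both orientations of an edge are arcs and carry the weight of that edge.\<close>

record 'a weighted_graph =
  ugraph :: "'a pair_pre_digraph"
  weight :: "('a \<times> 'a) weight_fun"

definition weighted_signed_graph :: "'a weighted_graph \<Rightarrow> bool" where
  "weighted_signed_graph G \<longleftrightarrow>
     pair_graph (ugraph G) \<and>
     (\<forall>(u, v) \<in> parcs (ugraph G). weight G (u, v) = weight G (v, u)) \<and>
     (\<forall>e \<in> parcs (ugraph G). weight G e \<noteq> 0)"

definition abs_graph :: "'a weighted_graph \<Rightarrow> 'a weighted_graph" where
  "abs_graph G = G\<lparr>weight := (\<lambda>e. \<bar>weight G e\<bar>)\<rparr>"

text \<open>Matrices are indexed by the finite vertex set, hence no enumeration of the vertices
  is needed; the index set is passed to the permanent.\<close>

definition adjacency_matrix :: "'a weighted_graph \<Rightarrow> 'a \<Rightarrow> 'a \<Rightarrow> real" where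
  "adjacency_matrix G i j = (if (i, j) \<in> parcs (ugraph G) then weight G (i, j) else 0)"

definition permanent :: "'a set \<Rightarrow> ('a \<Rightarrow> 'a \<Rightarrow> 'b::comm_semiring_1) \<Rightarrow> 'b" where
  "permanent V A = (\<Sum>p | p permutes V. \<Prod>i\<in>V. A i (p i))"

text \<open>For a symmetric digraph, the strongly connected components are the connected
  components of the undirected graph. A cut-vertex is one whose deletion increases their
  number, so the only vertex of a one-vertex graph is not a cut-vertex.\<close>

definition cut_vertex :: "('a, 'b) pre_digraph \<Rightarrow> 'a \<Rightarrow> bool" where
  "cut_vertex H v \<longleftrightarrow>
     v \<in> verts H \<and>
     card (pre_digraph.sccs (pre_digraph.del_vert H v)) > card (pre_digraph.sccs H)"

text \<open>The conjunct \<^term>\<open>graph H\<close> restricts sub-digraphs to those that are symmetric,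
  i.e. to undirected subgraphs.\<close>

definition block :: "('a, 'b) pre_digraph \<Rightarrow> ('a, 'b) pre_digraph \<Rightarrow> bool" where
  "block G B \<longleftrightarrow>
     pre_digraph.max_subgraph G
       (\<lambda>H. graph H \<and> Digraph_Component.connected H \<and> (\<nexists>v. cut_vertex H v)) B"

definition block_graph :: "('a, 'b) pre_digraph \<Rightarrow> bool" where
  "block_graph G \<longleftrightarrow> (\<forall>B. block G B \<longrightarrow> complete_digraph (card (verts B)) B)"

definition weighted_signed_block_graph :: "'a weighted_graph \<Rightarrow> bool" where
  "weighted_signed_block_graph G \<longleftrightarrow>
     weighted_signed_graph G \<and> block_graph (with_proj (ugraph G))"

definition is_triangle :: "'a weighted_graph \<Rightarrow> ('a \<times> 'a) list \<Rightarrow> bool" where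
  "is_triangle G c \<longleftrightarrow> pre_digraph.cycle (with_proj (ugraph G)) c \<and> length c = 3"

definition balanced :: "'a weighted_graph \<Rightarrow> ('a \<times> 'a) list \<Rightarrow> bool" where
  "balanced G c \<longleftrightarrow> prod_list (map (weight G) c) > 0"

end

theory Submission
  imports Defs "HOL-Combinatorics.Orbits"
begin

text \<open>
  Consider a permutation \<open>p\<close> whose term in the permanent is nonzero. Each orbit of \<open>p\<close> is traversed
  by a closed walk of \<open>G\<close>, and deleting one vertex of the orbit leaves a path; hence the subgraph
  induced on the orbit has no cut-vertex, lies in a block, and is a clique. Fix a root \<open>r\<close> in every
  orbit and put \<open>c(i) = w(r, i)\<close> and \<open>c(r) = 1\<close>. Balance of the triangle \<open>r, i, p(i)\<close> says that
  \<open>w(i, p(i)) c(i) c(p(i)) > 0\<close>. Multiplying over all \<open>i\<close>, the factors \<open>c\<close> combine to a square,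
  so the term of \<open>p\<close> is positive and equals its absolute value.
\<close>

text \<open>A strongly connected digraph is its own only strong component. So both component counts
  compared in \<open>cut_vertex\<close> are 1.\<close>

lemma no_cut_vertexI:
  assumes "wf_digraph H" "strongly_connected H"
    and "\<And>v. v \<in> verts H \<Longrightarrow> strongly_connected (pre_digraph.del_vert H v)"
  shows "\<nexists>v. cut_vertex H v"
proof -
  interpret wf_digraph H by fact
  have "card (pre_digraph.sccs (del_vert v)) = card sccs" if "v \<in> verts H" for v
  proof -
    interpret D: wf_digraph "del_vert v" by (rule wf_digraph_del_vert)
    have "D.sccs = {del_vert v}" "sccs = {H}"
      using assms that D.strongly_connected_eq_iff strongly_connected_eq_iff by blast+
    then show ?thesis by simp
  qed
  then show ?thesis unfolding cut_vertex_def by force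
qed

lemma (in sym_digraph) strongly_connectedI_reachable_from:
  assumes "u \<in> verts G" "\<And>v. v \<in> verts G \<Longrightarrow> u \<rightarrow>\<^sup>* v"
  shows "strongly_connected G"
proof (rule strongly_connectedI)
  show "verts G \<noteq> {}" using assms(1) by blast
  show "v \<rightarrow>\<^sup>* w" if "v \<in> verts G" "w \<in> verts G" for v w
    using that assms(2) symmetric_reachable' reachable_trans by blast
qed

text \<open>Among the subgraphs with \<open>P\<close> that contain \<open>H\<close>, take one with
  the largest number of vertices plus arcs. Both counts grow along inclusion, so an extension with
  the same sum has the same vertices and arcs. This is what places a subgraph without a cut-vertex
  inside a block.\<close>

lemma (in fin_digraph) max_subgraph_extends:
  assumes "subgraph H G" "P H"
  obtains B where "max_subgraph P B" "subgraph H B"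
proof -
  let ?Q = "\<lambda>B. subgraph B G \<and> P B \<and> subgraph H B"
  let ?f = "\<lambda>B. card (verts B) + card (arcs B)"
  have mono: "card (verts A) \<le> card (verts B) \<and> card (arcs A) \<le> card (arcs B)"
    if "subgraph A B" "subgraph B G" for A B
  proof -
    interpret B: fin_digraph B using that(2) by (rule fin_digraph_subgraph)
    show ?thesis using that(1) by (auto intro!: card_mono simp: subgraph_def)
  qed
  have "?Q H" using assms wf_digraph.subgraph_refl by (auto simp: subgraph_def compatible_def)
  \<comment> \<open>The bound is strict, hence \<open>Suc\<close>: \<open>G\<close> itself may
    satisfy \<open>?Q\<close>.\<close>
  moreover have "\<forall>B. ?Q B \<longrightarrow> ?f B < Suc (?f G)"
    using mono[OF _ subgraph_refl] by (meson add_mono le_imp_less_Suc)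
  ultimately have "\<exists>B. ?Q B \<and> (\<forall>B'. ?Q B' \<longrightarrow> ?f B' \<le> ?f B)"
    by (rule ex_has_greatest_nat)
  then obtain B where B: "?Q B" and max: "\<forall>B'. ?Q B' \<longrightarrow> ?f B' \<le> ?f B" by (elim exE conjE) simp
  have "B' = B" if "subgraph B B'" "subgraph B' G" "P B'" for B'
  proof -
    interpret B': fin_digraph B' using that(2) by (rule fin_digraph_subgraph)
    have "subgraph H B'" using B that(1) by (blast intro: subgraph_trans)
    then have "?f B' \<le> ?f B" using that by (intro max[rule_format]) simp
    then have "card (verts B) = card (verts B')" "card (arcs B) = card (arcs B')"
      using mono[OF that(1,2)] by auto
    moreover have "verts B \<subseteq> verts B'" "arcs B \<subseteq> arcs B'"
      and "tail B = tail B'" "head B = head B'"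
      using that(1) by (auto simp: subgraph_def compatible_def)
    ultimately have "verts B = verts B'" "arcs B = arcs B'"
      using B'.finite_verts B'.finite_arcs card_subset_eq by blast+
    then show ?thesis
      using \<open>tail B = tail B'\<close> \<open>head B = head B'\<close> by (intro pre_digraph.equality) simp_all
  qed
  then have "max_subgraph P B" using B unfolding max_subgraph_def by blast
  with B show thesis using that by blast
qed

context graph
begin

context
  fixes f :: "'a \<Rightarrow> 'a" and S :: "'a set"
  assumes cyclic: "cyclic_on f S"
    and adj: "\<And>x. x \<in> S \<Longrightarrow> x \<rightarrow>\<^bsub>G\<^esub> f x"
begin

lemma cyclic_subset_verts: "S \<subseteq> verts G"
  using adj adj_in_verts by blast

lemma graph_induce_cyclic: "graph (G \<restriction> S)"
proof -
  have ind: "induced_subgraph (G \<restriction> S) G"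
    using cyclic_subset_verts by (rule induced_induce)
  interpret H: digraph "G \<restriction> S" using ind by (rule digraphI_induced)
  interpret H: sym_digraph "G \<restriction> S" using ind by (rule induced_graph_imp_graph)
  show ?thesis by unfold_locales
qed

text \<open>Iterating \<open>f\<close> from any point of \<open>S\<close> reaches all of
  \<open>S\<close>. In a symmetric digraph one such source suffices.\<close>

lemma strongly_connected_induce_cyclic: "strongly_connected (G \<restriction> S)"
proof -
  interpret H: graph "G \<restriction> S" by (rule graph_induce_cyclic)
  obtain s where s: "s \<in> S" "S = orbit f s" using cyclic unfolding cyclic_on_def by blast
  have step: "x \<rightarrow>\<^bsub>G \<restriction> S\<^esub> f x" if "x \<in> S" for x
  proof -
    have "f x \<in> S" using that s(2) by (auto intro: orbit.step)
    with adj[OF that] that show ?thesis by (auto simp: arcs_ends_conv)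
  qed
  have "s \<rightarrow>\<^sup>*\<^bsub>G \<restriction> S\<^esub> y" if "y \<in> orbit f s" for y
    using that
  proof induct
    case base
    show ?case using step[OF s(1)] by (rule H.reachable_adjI)
  next
    case (step y)
    then show ?case using \<open>\<And>x. x \<in> S \<Longrightarrow> x \<rightarrow>\<^bsub>G \<restriction> S\<^esub> f x\<close> s(2) H.reachable_adj_trans by blast
  qed
  then show ?thesis using s by (intro H.strongly_connectedI_reachable_from[of s]) auto
qed

text \<open>Cutting the cyclic walk at \<open>v\<close> leaves the path \<open>f v\<close>,
  \<open>f (f v)\<close>, ..., which still visits every other vertex of \<open>S\<close>.\<close>

lemma strongly_connected_induce_cyclic_del_vert:
  assumes "v \<in> S"
  shows "strongly_connected (pre_digraph.del_vert (G \<restriction> S) v)"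
proof -
  interpret H: graph "G \<restriction> S" by (rule graph_induce_cyclic)
  let ?D = "H.del_vert v"
  have "symmetric ?D"
    using H.sym_arcs unfolding symmetric_conv by (fastforce simp: H.del_vert_simps)
  then interpret D: sym_digraph ?D
    by (intro wf_digraph.sym_digraphI H.wf_digraph_del_vert)
  have S: "S = orbit f v" using cyclic assms unfolding cyclic_on_alldef by blast
  have fS: "f x \<in> S" if "x \<in> S" for x using that S by (auto intro: orbit.step)
  \<comment> \<open>Absence of loops gives \<open>f v\<close> \<noteq> \<open>v\<close>, so the
    deletion leaves a nonempty graph.\<close>
  have fv: "f v \<in> verts ?D"
    using assms fS adj adj_not_same by (auto simp: H.verts_del_vert) metis
  have step: "x \<rightarrow>\<^bsub>?D\<^esub> f x" if "x \<in> S" "x \<noteq> v" "f x \<noteq> v" for x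
    using adj[OF that(1)] that fS[OF that(1)] by (auto simp: arcs_ends_conv H.del_vert_simps)
  \<comment> \<open>The orbit runs through \<open>v\<close> itself when it closes up, hence the
    first disjunct. One step after \<open>v\<close> the walk is back at its start
    \<open>f v\<close>.\<close>
  have "y = v \<or> f v \<rightarrow>\<^sup>*\<^bsub>?D\<^esub> y" if "y \<in> orbit f v" for y
    using that
  proof induct
    case base
    show ?case using fv by blast
  next
    case (step y)
    then show ?case
      using \<open>\<And>x. x \<in> S \<Longrightarrow> x \<noteq> v \<Longrightarrow> f x \<noteq> v \<Longrightarrow> x \<rightarrow>\<^bsub>?D\<^esub> f x\<close> S fv
        D.reachable_adj_trans D.reachable_refl by metis
  qed
  then have "f v \<rightarrow>\<^sup>*\<^bsub>?D\<^esub> y" if "y \<in> verts ?D" for y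
    using that unfolding H.verts_del_vert induce_subgraph_verts using S by blast
  with fv show ?thesis by (rule D.strongly_connectedI_reachable_from)
qed

text \<open>The subgraph induced on \<open>S\<close> is connected without a cut-vertex, so it
  extends to a block. That block is complete, and its arcs are arcs of \<open>G\<close>.\<close>

lemma block_graph_cyclic_clique:
  assumes "block_graph G" "u \<in> S" "v \<in> S" "u \<noteq> v"
  shows "u \<rightarrow>\<^bsub>G\<^esub> v"
proof -
  interpret H: graph "G \<restriction> S" by (rule graph_induce_cyclic)
  \<comment> \<open>Connectedness means strong connectedness of the symmetric closure, and closing
    already symmetric arcs does not change reachability.\<close>
  have "connected (G \<restriction> S)"
    using strongly_connected_induce_cyclic H.reachable_mk_symmetric_eq[OF H.sym_arcs]
    by (simp add: connected_def strongly_connected_def)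
  moreover have "\<nexists>v. cut_vertex (G \<restriction> S) v"
    using strongly_connected_induce_cyclic strongly_connected_induce_cyclic_del_vert
    by (intro no_cut_vertexI) auto
  moreover have "subgraph (G \<restriction> S) G"
    using cyclic_subset_verts by (intro induced_imp_subgraph induced_induce)
  ultimately obtain B where B: "block G B" "subgraph (G \<restriction> S) B"
    unfolding block_def using graph_induce_cyclic
    by (elim max_subgraph_extends[where
          P = "\<lambda>H. graph H \<and> connected H \<and> (\<nexists>v. cut_vertex H v)"]) auto
  then have "complete_digraph (card (verts B)) B" using assms(1) unfolding block_graph_def by blast
  moreover have "u \<in> verts B" "v \<in> verts B" using B(2) assms by (auto simp: subgraph_def)
  ultimately have "u \<rightarrow>\<^bsub>B\<^esub> v" using assms(4) unfolding complete_digraph_def by blast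
  moreover have "subgraph B G"
    using B(1) unfolding block_def by (rule subgraphI_max_subgraph)
  ultimately show ?thesis by (auto simp: arcs_ends_conv subgraph_def compatible_def)
qed

end

end

text \<open>Since \<open>p\<close> only reindexes the product of the \<open>c i\<close>, the extra
  factor is a square. No sign condition on \<open>c\<close> is required, and strict positivity of
  the whole excludes zero.\<close>

lemma prod_permutes_pos:
  fixes A :: "'a \<Rightarrow> 'a \<Rightarrow> 'b::linordered_idom"
  assumes "p permutes V"
    and "\<And>i. i \<in> V \<Longrightarrow> A i (p i) * c i * c (p i) > 0"
  shows "(\<Prod>i\<in>V. A i (p i)) > 0"
proof -
  have "0 < (\<Prod>i\<in>V. A i (p i) * c i * c (p i))" using assms(2) by (rule prod_pos)
  also have "\<dots> = (\<Prod>i\<in>V. A i (p i)) * (\<Prod>i\<in>V. c i) * (\<Prod>i\<in>V. c (p i))"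
    by (simp add: prod.distrib)
  also have "(\<Prod>i\<in>V. c (p i)) = (\<Prod>i\<in>V. c i)"
    using prod.permute[OF assms(1), of c] by (simp add: o_def)
  finally have "0 < (\<Prod>i\<in>V. A i (p i)) * (\<Prod>i\<in>V. c i)\<^sup>2"
    by (simp add: power2_eq_square mult.assoc)
  then show ?thesis by (simp add: zero_less_mult_iff)
qed

lemma is_triangleI:
  assumes "pair_graph (ugraph G)"
    and "(a, b) \<in> parcs (ugraph G)" "(b, c) \<in> parcs (ugraph G)" "(c, a) \<in> parcs (ugraph G)"
  shows "is_triangle G [(a, b), (b, c), (c, a)]"
proof -
  interpret pair_graph "ugraph G" by fact
  have "a \<noteq> b" "b \<noteq> c" "c \<noteq> a" using assms(2-) no_loops' by blast+
  moreover have "awalk a [(a, b), (b, c), (c, a)] a"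
    using assms(2-) by (auto simp: awalk_def dest: in_arcsD1)
  ultimately show ?thesis unfolding is_triangle_def cycle_def by force
qed

lemma permutation_term_pos:
  assumes "weighted_signed_block_graph G"
    and balanced: "\<And>c. is_triangle G c \<Longrightarrow> balanced G c"
    and p: "p permutes pverts (ugraph G)"
    and arc: "\<And>i. i \<in> pverts (ugraph G) \<Longrightarrow> (i, p i) \<in> parcs (ugraph G)"
  shows "(\<Prod>i\<in>pverts (ugraph G). weight G (i, p i)) > 0"
proof -
  have pg: "pair_graph (ugraph G)" and bg: "block_graph (with_proj (ugraph G))"
    and wsym: "\<And>u v. (u, v) \<in> parcs (ugraph G) \<Longrightarrow> weight G (u, v) = weight G (v, u)"
    and w0: "\<And>e. e \<in> parcs (ugraph G) \<Longrightarrow> weight G e \<noteq> 0"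
    using assms(1) unfolding weighted_signed_block_graph_def weighted_signed_graph_def by auto
  interpret pair_graph "ugraph G" by fact
  have perm: "permutation p" using p pair_finite_verts permutation_permutes by blast
  \<comment> \<open>The choice depends only on the orbit as a set, so all points of an orbit receive
    the same root.\<close>
  define r where "r i = (SOME x. x \<in> orbit p i)" for i
  \<comment> \<open>The root carries no loop whose weight could be used; the value 1 there leaves
    signs unchanged.\<close>
  define c where "c i = (if i = r i then 1 else weight G (r i, i))" for i
  have r_in: "r i \<in> orbit p i" for i
    unfolding r_def using orbit.base[of p i] by (rule someI)
  have r_p: "r (p i) = r i" for i unfolding r_def permutation_orbit_step[OF perm] ..
  have "weight G (i, p i) * c i * c (p i) > 0" if i: "i \<in> pverts (ugraph G)" for i
  proof -
    let ?S = "orbit p i"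
    have sub: "?S \<subseteq> pverts (ugraph G)" using p i by (rule permutes_orbit_subset)
    have clique: "(u, v) \<in> parcs (ugraph G)" if "u \<in> ?S" "v \<in> ?S" "u \<noteq> v" for u v
      using block_graph_cyclic_clique[OF cyclic_on_orbit'[OF perm] _ bg that] arc sub by auto
    have iS: "i \<in> ?S" "p i \<in> ?S"
      using perm by (auto intro: permutation_self_in_orbit orbit.base)
    note wi = wsym[OF arc[OF i]] w0[OF arc[OF i]]
    \<comment> \<open>If the root is an endpoint of the edge from \<open>i\<close> to
      \<open>p i\<close>, the expression is the square of that nonzero weight; this covers orbits of
      length 2. Otherwise the three vertices are distinct and form a triangle of the clique.\<close>
    consider "i = r i" | "p i = r i" | "i \<noteq> r i" "p i \<noteq> r i" by blast
    then show ?thesis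
    proof cases
      case 1
      then have "p i \<noteq> r i" using no_loops'[OF arc[OF i]] by auto
      with 1 show ?thesis using wi by (simp add: c_def r_p flip: power2_eq_square)
    next
      case 2
      then have "i \<noteq> r i" using no_loops'[OF arc[OF i]] by auto
      with 2 have "c i = weight G (p i, i)" "c (p i) = 1"
        using r_p[of i] by (simp_all add: c_def)
      then show ?thesis using wi by (simp flip: power2_eq_square)
    next
      case 3
      have "is_triangle G [(r i, i), (i, p i), (p i, r i)]"
        using 3 iS r_in by (intro is_triangleI pg clique arc i) auto
      from balanced[OF this]
      have "weight G (r i, i) * (weight G (i, p i) * weight G (p i, r i)) > 0"
        by (simp add: balanced_def)
      \<comment> \<open>The triangle traverses its last edge towards the root, whereas
        \<open>c\<close> reads it from the root.\<close>
      also have "weight G (p i, r i) = weight G (r i, p i)"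
        using 3 iS r_in by (intro wsym clique) auto
      finally show ?thesis using 3 by (simp add: c_def r_p mult_ac)
    qed
  qed
  with p show ?thesis by (rule prod_permutes_pos)
qed

theorem theorem4:
  fixes G :: "'a weighted_graph"
  assumes "weighted_signed_block_graph G"
    and "\<And>c. is_triangle G c \<Longrightarrow> balanced G c"
  shows "permanent (pverts (ugraph G)) (adjacency_matrix G) =
         permanent (pverts (ugraph (abs_graph G))) (adjacency_matrix (abs_graph G))"
proof -
  let ?V = "pverts (ugraph G)"
  have fin: "finite ?V"
    using assms(1) unfolding weighted_signed_block_graph_def weighted_signed_graph_def
    by (auto dest: pair_graph.axioms(1) intro: pair_fin_digraph.pair_finite_verts pair_digraph.axioms(1))
  have abs: "adjacency_matrix (abs_graph G) i j = \<bar>adjacency_matrix G i j\<bar>" for i j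
    by (simp add: adjacency_matrix_def abs_graph_def)
  \<comment> \<open>The permanents agree term by term: each term for \<open>abs_graph G\<close> is
    the absolute value of the term for \<open>G\<close>, which is positive or zero.\<close>
  have "(\<Prod>i\<in>?V. adjacency_matrix G i (p i)) = (\<Prod>i\<in>?V. \<bar>adjacency_matrix G i (p i)\<bar>)"
    if p: "p permutes ?V" for p
  proof (cases "\<forall>i\<in>?V. (i, p i) \<in> parcs (ugraph G)")
    case True
    then have "(\<Prod>i\<in>?V. adjacency_matrix G i (p i)) = (\<Prod>i\<in>?V. weight G (i, p i))"
      by (simp add: adjacency_matrix_def)
    also have "\<dots> > 0" using True by (intro permutation_term_pos[OF assms p]) auto
    finally show ?thesis by (simp flip: abs_prod)
  next
    \<comment> \<open>Some \<open>i\<close> is not joined to \<open>p i\<close>, for instance a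
      fixed point. Finiteness of the index set lets this zero entry annihilate the product.\<close>
    case False
    then have "(\<Prod>i\<in>?V. adjacency_matrix G i (p i)) = 0"
      using fin by (auto simp: adjacency_matrix_def prod_zero_iff)
    then show ?thesis by (simp flip: abs_prod)
  qed
  moreover have "pverts (ugraph (abs_graph G)) = ?V" by (simp add: abs_graph_def)
  ultimately show ?thesis by (simp add: permanent_def abs)
qed

end
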